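(* If $G$ is a connected graph on $4$ or more vertices, then $G^4$ is $4$-ordered Hamiltonian.
   Context: All graphs are finite simple graphs. $d_G(v,w)$ denotes the distance in $G$ between vertices $v$ and $w$. For a positive integer $n$, the $n$-th power $G^n$ of a graph $G$ is the simple graph with the same vertex set as $G$ in which two distinct vertices $v,w$ are adjacent if and only if $d_G(v,w)\leq n$. A graph $G$ is $k$-ordered Hamiltonian if for any sequence $v_1,v_2,\dots,v_k$ of $k$ distinct vertices of $G$ there is a Hamiltonian cycle in $G$ containing these vertices in the given order, i.e. traversing the cycle from $v_1$ in one of its two directions, one meets $v_1,v_2,\dots,v_k$ in this order before returning to $v_1$. *)

theory Defs
  imports "Graph_Theory.Graph_Theory" "HOL-Library.Sublist"
begin

text \<open>
  Finite simple graphs are the symmetric, loopfree, finite digraphs of \<^locale>\<open>pair_graph\<close>: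
  an edge between \<open>v\<close> and \<open>w\<close> is the pair of arcs \<open>(v, w)\<close> and \<open>(w, v)\<close>.
\<close>

text \<open>Every arc costs 1, so the cost of a walk is its length; the distance is \<open>\<infinity>\<close> if there is no walk.\<close>

definition graph_dist :: "'a pair_pre_digraph \<Rightarrow> 'a \<Rightarrow> 'a \<Rightarrow> ereal" where
  "graph_dist G v w = wf_digraph.\<mu> (with_proj G) (\<lambda>_. 1) v w"

definition graph_power :: "'a pair_pre_digraph \<Rightarrow> nat \<Rightarrow> 'a pair_pre_digraph" where
  "graph_power G n = \<lparr> pverts = pverts G,
     parcs = {(v, w). v \<in> pverts G \<and> w \<in> pverts G \<and> v \<noteq> w \<and> graph_dist G v w \<le> ereal (real n)} \<rparr>"

text \<open>
  A cycle is given by its list of consecutive arcs, so \<open>map fst p\<close> lists its vertices. The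
  length bound excludes the closed walks \<open>[(a, b), (b, a)]\<close>, which \<^const>\<open>pre_digraph.cycle\<close>
  admits in a symmetric digraph.
\<close>

definition hamiltonian_cycle :: "'a pair_pre_digraph \<Rightarrow> ('a \<times> 'a) awalk \<Rightarrow> bool" where
  "hamiltonian_cycle G p \<longleftrightarrow>
     pre_digraph.cycle (with_proj G) p \<and> 3 \<le> length p \<and> set (map fst p) = pverts G"

text \<open>
  The list \<open>q\<close> is one traversal of the cycle \<open>p\<close>, in either direction, that starts at the first
  vertex of \<open>vs\<close>; it ends with the arc that returns to this vertex.
\<close>

definition cycle_visits_in_order :: "('a \<times> 'a) awalk \<Rightarrow> 'a list \<Rightarrow> bool" where
  "cycle_visits_in_order p vs \<longleftrightarrow>
     (\<exists>q j. (q = rotate j p \<or> q = rotate j (rev_path p)) \<and>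
        (vs \<noteq> [] \<longrightarrow> fst (hd q) = hd vs) \<and> subseq vs (map fst q))"

definition k_ordered_hamiltonian :: "nat \<Rightarrow> 'a pair_pre_digraph \<Rightarrow> bool" where
  "k_ordered_hamiltonian k G \<longleftrightarrow>
     (\<forall>vs. length vs = k \<and> distinct vs \<and> set vs \<subseteq> pverts G \<longrightarrow>
        (\<exists>p. hamiltonian_cycle G p \<and> cycle_visits_in_order p vs))"

end

theory Submission
  imports Defs
begin

text \<open>
  A Hamiltonian cycle of \<open>G\<^sup>4\<close> is built by induction on the number of vertices. To be able to
  insert new vertices, each edge \<open>xy\<close> of the cycle is labelled by a vertex \<open>w\<close> that it serves: \<open>w\<close> is
  within distance 2 of one end and 3 of the other, and every vertex is the label of exactly one edge.
  A non-cut vertex \<open>l\<close> with a neighbour \<open>u\<close> is then inserted into the edge that serves \<open>u\<close>, and the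
  two new edges serve \<open>u\<close> and \<open>l\<close>.

  In this way all non-cut vertices other than the four prescribed ones are removed first. After that
  the prescribed vertices \<open>w\<close> satisfy a stronger condition: the edge labelled \<open>w\<close> contains \<open>w\<close> and
  has length at most 3. If a prescribed non-cut vertex \<open>l\<close> has a neighbour \<open>u\<close> that is not prescribed,
  delete \<open>l\<close> and prescribe \<open>u\<close> instead; afterwards \<open>l\<close> is inserted next to \<open>u\<close> and takes over its
  place in the order. All non-cut vertices remain prescribed, so the process stops either at a graph of
  diameter at most 3, where every cyclic arrangement will do, or at a path whose first two and
  last two vertices are the prescribed ones, where the cycles are written down explicitly.
\<close>

section \<open>Labelled walks\<close>

text \<open>A step is a pair of a label and the vertex that it leads to. The start is kept apart, so
  that for a closed walk around a cycle \<open>map snd ts\<close> lists each vertex once, the start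
  coming last.\<close>

fun labelled_walk :: "('b \<Rightarrow> 'a \<Rightarrow> 'a \<Rightarrow> bool) \<Rightarrow> 'a \<Rightarrow> ('b \<times> 'a) list \<Rightarrow> 'a \<Rightarrow> bool" where
  "labelled_walk P x [] y \<longleftrightarrow> x = y"
| "labelled_walk P x ((w, z) # ts) y \<longleftrightarrow> P w x z \<and> labelled_walk P z ts y"

lemma labelled_walk_append:
  "labelled_walk P x (ts @ us) y \<longleftrightarrow> (\<exists>z. labelled_walk P x ts z \<and> labelled_walk P z us y)"
  by (induction ts arbitrary: x) auto

lemma labelled_walk_last: "labelled_walk P x ts y \<Longrightarrow> last (x # map snd ts) = y"
  by (induction P x ts y rule: labelled_walk.induct) auto

lemma labelled_walk_rev:
  assumes "labelled_walk P x ts y" and "\<And>w a b. P w a b \<Longrightarrow> P w b a"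
  shows "\<exists>us. labelled_walk P y us x \<and> map fst us = rev (map fst ts) \<and>
    y # map snd us = rev (x # map snd ts)"
  using assms(1)
proof (induction ts arbitrary: x)
  case Nil
  then show ?case by auto
next
  case (Cons t ts)
  obtain w z where t: "t = (w, z)" by force
  with Cons obtain us where us: "labelled_walk P y us z" "map fst us = rev (map fst ts)"
    "y # map snd us = rev (z # map snd ts)"
    by auto
  have "labelled_walk P y (us @ [(w, x)]) x"
    using us(1) Cons.prems t assms(2) by (auto simp: labelled_walk_append)
  moreover have "map fst (us @ [(w, x)]) = rev (map fst (t # ts))"
    using us(2) t by simp
  moreover have "y # map snd (us @ [(w, x)]) = rev (x # map snd (t # ts))"
    using us(3) t by simp
  ultimately show ?case by blast
qed

lemma labelled_walk_mono:
  assumes "labelled_walk P x ts y"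
    and "\<And>w a b. w \<in> fst ` set ts \<Longrightarrow> P w a b \<Longrightarrow> Q w a b"
  shows "labelled_walk Q x ts y"
  using assms by (induction P x ts y rule: labelled_walk.induct) auto

lemma labelled_walk_map:
  assumes "labelled_walk P x ts y" "x \<in> A" "snd ` set ts \<subseteq> A" "fst ` set ts \<subseteq> B"
    and "\<And>w a b. w \<in> B \<Longrightarrow> a \<in> A \<Longrightarrow> b \<in> A \<Longrightarrow> P w a b \<Longrightarrow> Q (g w) (f a) (f b)"
  shows "labelled_walk Q (f x) (map (map_prod g f) ts) (f y)"
  using assms by (induction P x ts y rule: labelled_walk.induct) auto

text \<open>Each edge is labelled by the end it leads to; this labelling is used when the diameter
  is at most 3.\<close>

lemma labelled_walk_diag:
  assumes "\<And>v a. v \<in> S \<Longrightarrow> a \<in> S \<Longrightarrow> P v a v" "x \<in> S" "set xs \<subseteq> S"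
  shows "labelled_walk P x (map (\<lambda>v. (v, v)) xs) (last (x # xs))"
  using assms(2,3) by (induction xs arbitrary: x) (auto intro: assms(1))

section \<open>Cyclic orders\<close>

text \<open>A cycle has neither a start nor a direction, so the order of the prescribed vertices
  along it is compared modulo the dihedral group.\<close>

definition dihedral :: "'a list \<Rightarrow> 'a list \<Rightarrow> bool" where
  "dihedral vs ys \<longleftrightarrow> (\<exists>j. ys = rotate j vs \<or> ys = rotate j (rev vs))"

lemma dihedral_refl: "dihedral vs vs"
  unfolding dihedral_def by (metis rotate0 id_apply)

lemma dihedral_append_commute:
  assumes "dihedral vs (xs @ ys)"
  shows "dihedral vs (ys @ xs)"
proof -
  have "ys @ xs = rotate (length xs) (xs @ ys)"
    by (simp add: rotate_append)
  with assms show ?thesis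
    unfolding dihedral_def by (metis rotate_rotate)
qed

lemma dihedral_map: "dihedral vs ys \<Longrightarrow> dihedral (map f vs) (map f ys)"
  unfolding dihedral_def by (metis rotate_map rev_map)

lemma rotate_four:
  "(\<exists>j. ys = rotate j [p, q, r, s]) \<longleftrightarrow> ys \<in> {[p, q, r, s], [q, r, s, p], [r, s, p, q], [s, p, q, r]}"
proof
  have "rotate j [p, q, r, s] \<in> {[p, q, r, s], [q, r, s, p], [r, s, p, q], [s, p, q, r]}" for j
  proof (induction j)
    case (Suc j)
    then show ?case
      by (elim insertE emptyE)
        (simp_all only: rotate_Suc rotate1.simps append.simps insert_iff simp_thms)
  qed simp
  moreover assume "\<exists>j. ys = rotate j [p, q, r, s]"
  ultimately show "ys \<in> {[p, q, r, s], [q, r, s, p], [r, s, p, q], [s, p, q, r]}"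
    by (elim exE) (simp only:)
next
  assume "ys \<in> {[p, q, r, s], [q, r, s, p], [r, s, p, q], [s, p, q, r]}"
  then have "ys = rotate 0 [p, q, r, s] \<or> ys = rotate (Suc 0) [p, q, r, s] \<or>
      ys = rotate (Suc (Suc 0)) [p, q, r, s] \<or> ys = rotate (Suc (Suc (Suc 0))) [p, q, r, s]"
    by (simp only: insert_iff empty_iff rotate_Suc rotate0 id_apply rotate1.simps append.simps simp_thms)
  then show "\<exists>j. ys = rotate j [p, q, r, s]"
    by (elim disjE) (rule exI, assumption)+
qed

lemma dihedral4:
  "dihedral [a, b, c, d] ys \<longleftrightarrow>
     ys \<in> {[a,b,c,d], [b,c,d,a], [c,d,a,b], [d,a,b,c], [d,c,b,a], [c,b,a,d], [b,a,d,c], [a,d,c,b]}"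
proof -
  have "rev [a, b, c, d] = [d, c, b, a]" by simp
  then show ?thesis
    unfolding dihedral_def ex_disj_distrib
    by (simp only: rotate_four insert_iff empty_iff disj_assoc simp_thms)
qed

text \<open>Up to direction, four elements have three cyclic orders, one for each choice of the
  element opposite \<open>a\<close>. Rotating \<open>a\<close> to the front and reflecting if
  necessary reaches one of the listed forms.\<close>

lemma dihedral_cases:
  assumes "distinct vs" "length vs = 4" "set vs = {a, b, c, d}"
  obtains "dihedral vs [a, b, c, d]" | "dihedral vs [a, b, d, c]" | "dihedral vs [a, c, b, d]"
proof -
  obtain as bs where vs: "vs = as @ a # bs"
    using assms(3) by (metis insertI1 split_list)
  have "length (bs @ as) = 3" using assms(2) vs by simp
  then obtain x y z where xyz: "bs @ as = [x, y, z]"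
    by (auto simp: numeral_eq_Suc length_Suc_conv simp del: length_append)
  have dih: "dihedral vs [a, x, y, z]"
    using dihedral_append_commute[of vs as "a # bs"] dihedral_refl[of vs] xyz vs by simp
  obtain p q r s where "vs = [p, q, r, s]"
    using assms(2) by (auto simp: numeral_eq_Suc length_Suc_conv)
  then have "dihedral vs [a, z, y, x]"
    using dih by (simp only: dihedral4 insert_iff empty_iff list.inject) metis
  have "set vs = insert a (set (bs @ as))" "a \<notin> set (bs @ as)" "distinct (bs @ as)"
    using vs assms(1) by auto
  then have set: "insert a {x, y, z} = {a, b, c, d}" and axyz: "distinct [a, x, y, z]"
    unfolding xyz assms(3) by simp_all
  have "card {a, b, c, d} = 4" unfolding set[symmetric] using axyz by simp
  then have abcd: "distinct [a, b, c, d]" by (intro card_distinct) simp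
  have "{x, y, z} = insert a {x, y, z} - {a}" using axyz by auto
  also have "\<dots> = {b, c, d}" unfolding set using abcd by auto
  finally have eq: "{x, y, z} = {b, c, d}" .
  have yz: "{y, z} = {b, c, d} - {x}" unfolding eq[symmetric] using axyz by auto
  have "x \<in> {b, c, d}" unfolding eq[symmetric] by simp
  then consider "x = b" "{y, z} = {c, d}" | "x = c" "{y, z} = {b, d}" | "x = d" "{y, z} = {b, c}"
    unfolding yz using abcd by force
  then show thesis
  proof cases
    case 1
    then show thesis using that dih by (auto simp: doubleton_eq_iff)
  next
    case 2
    then show thesis using that dih \<open>dihedral vs [a, z, y, x]\<close> by (auto simp: doubleton_eq_iff)
  next
    case 3
    then show thesis using that \<open>dihedral vs [a, z, y, x]\<close> by (auto simp: doubleton_eq_iff)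
  qed
qed

section \<open>Labelled cycles\<close>

text \<open>\<open>N k x y\<close> stands for: the distance of \<open>x\<close> and \<open>y\<close> is at most \<open>k\<close>.
  The stronger condition on labels is imposed for those in \<open>M\<close>.\<close>

definition serves :: "(nat \<Rightarrow> 'a \<Rightarrow> 'a \<Rightarrow> bool) \<Rightarrow> 'a set \<Rightarrow> 'a \<Rightarrow> 'a \<Rightarrow> 'a \<Rightarrow> bool" where
  "serves N M w x y \<longleftrightarrow> N 4 x y \<and> (N 2 w x \<and> N 3 w y \<or> N 3 w x \<and> N 2 w y) \<and>
     (w \<in> M \<longrightarrow> (w = x \<or> w = y) \<and> N 3 x y)"

text \<open>Labels and vertices both run bijectively through \<open>S\<close>, so every vertex is
  served by exactly one edge. In the two stages of the construction, \<open>M\<close> is empty or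
  equal to \<open>set vs\<close>.\<close>

definition labelled_cycle ::
    "(nat \<Rightarrow> 'a \<Rightarrow> 'a \<Rightarrow> bool) \<Rightarrow> 'a set \<Rightarrow> 'a set \<Rightarrow> 'a list \<Rightarrow> ('a \<times> 'a) list \<Rightarrow> bool" where
  "labelled_cycle N S M vs ts \<longleftrightarrow> (\<exists>x. labelled_walk (serves N M) x ts x) \<and>
     distinct (map fst ts) \<and> distinct (map snd ts) \<and> fst ` set ts = S \<and> snd ` set ts = S \<and>
     dihedral vs (filter (\<lambda>v. v \<in> set vs) (map snd ts))"

text \<open>Insertions take place in the edge with label \<open>u\<close>. Rotating the cycle until
  this edge is the last step turns them into a change at the end of the list.\<close>

lemma labelled_cycle_at_label:
  assumes "labelled_cycle N S M vs ts" "u \<in> S"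
  obtains bs z p where "labelled_cycle N S M vs (bs @ [(u, z)])"
    "labelled_walk (serves N M) z bs p" "serves N M u p z"
proof -
  obtain z where "(u, z) \<in> set ts"
    using assms unfolding labelled_cycle_def by force
  then obtain as cs where ts: "ts = as @ (u, z) # cs"
    by (meson split_list)
  obtain x p where w: "labelled_walk (serves N M) x as p" "serves N M u p z"
      "labelled_walk (serves N M) z cs x"
    using assms(1) unfolding labelled_cycle_def ts by (auto simp: labelled_walk_append)
  have zp: "labelled_walk (serves N M) z (cs @ as) p"
    using w by (auto simp: labelled_walk_append)
  have "labelled_walk (serves N M) z ((cs @ as) @ [(u, z)]) z"
    unfolding labelled_walk_append[of _ _ "cs @ as"] using w(2) zp by auto
  moreover have "dihedral vs (filter (\<lambda>v. v \<in> set vs) (map snd ((cs @ as) @ [(u, z)])))"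
    using assms(1) dihedral_append_commute[of vs
      "filter (\<lambda>v. v \<in> set vs) (map snd (as @ [(u, z)]))" "filter (\<lambda>v. v \<in> set vs) (map snd cs)"]
    unfolding labelled_cycle_def ts by (simp split: if_splits)
  moreover have "distinct (map fst ((cs @ as) @ [(u, z)]))" "distinct (map snd ((cs @ as) @ [(u, z)]))"
    "fst ` set ((cs @ as) @ [(u, z)]) = S" "snd ` set ((cs @ as) @ [(u, z)]) = S"
    using assms(1) unfolding labelled_cycle_def ts by auto
  ultimately have "labelled_cycle N S M vs ((cs @ as) @ [(u, z)])"
    unfolding labelled_cycle_def by blast
  with zp w(2) that show thesis by blast
qed

section \<open>The base case of a path\<close>

text \<open>An upper bound on the distance of two vertices of a path numbered from 0, written
  without truncated subtraction.\<close>

definition near_nat :: "nat \<Rightarrow> nat \<Rightarrow> nat \<Rightarrow> bool" where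
  "near_nat k i j \<longleftrightarrow> i \<le> j + k \<and> j \<le> i + k"

lemma serves_near_nat_sym: "serves near_nat M w a b \<Longrightarrow> serves near_nat M w b a"
  unfolding serves_def near_nat_def by auto

text \<open>The walk covers the left part of the path and has its two rightmost vertices as ends.
  There is one edge fewer than vertices, and the label \<open>k + 1\<close> stays free. The
  induction step reverses the walk and appends the jump from \<open>k\<close> to
  \<open>k + 2\<close>, labelled by this free vertex. Each reversal swaps the order of 0 and
  1.\<close>

lemma zigzag_path:
  assumes "1 \<le> k" "k + 3 \<le> D" and M: "M = {0, 1, D - 1, D}"
  shows "\<exists>ts. labelled_walk (serves near_nat M) k ts (k + 1) \<and>
    distinct (map fst ts) \<and> distinct (k # map snd ts) \<and>
    fst ` set ts = {..k} \<and> set (k # map snd ts) = {..k + 1} \<and>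
    filter (\<lambda>v. v \<in> M) (k # map snd ts) \<in> {[0, 1], [1, 0]}"
  using assms(1,2)
proof (induction k rule: dec_induct)
  case base
  let ?ts = "[(1, 0), (0, 2)] :: (nat \<times> nat) list"
  have "labelled_walk (serves near_nat M) 1 ?ts (1 + 1)"
    by (simp add: serves_def near_nat_def)
  moreover have "{..(1::nat)} = {0, 1}" "{..(2::nat)} = {0, 1, 2}" by auto
  moreover have "filter (\<lambda>v. v \<in> M) (1 # map snd ?ts) = [1, 0]"
    using base by (auto simp: M)
  ultimately show ?case
    by (intro exI[of _ ?ts]) (auto simp: numeral_2_eq_2)
next
  case (step k)
  then obtain ts where ts: "labelled_walk (serves near_nat M) k ts (k + 1)"
    "distinct (map fst ts)" "distinct (k # map snd ts)" "fst ` set ts = {..k}"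
    "set (k # map snd ts) = {..k + 1}"
    "filter (\<lambda>v. v \<in> M) (k # map snd ts) \<in> {[0, 1], [1, 0]}"
    by auto
  obtain us where us: "labelled_walk (serves near_nat M) (k + 1) us k"
    "map fst us = rev (map fst ts)" "(k + 1) # map snd us = rev (k # map snd ts)"
    using labelled_walk_rev[OF ts(1) serves_near_nat_sym] by blast
  let ?us = "us @ [(k + 1, k + 2)]"
  have "k + 1 \<notin> M" "k + 2 \<notin> M" using step M by auto
  have "serves near_nat M (k + 1) k (k + 2)"
    using \<open>k + 1 \<notin> M\<close> by (simp add: serves_def near_nat_def)
  then have walk: "labelled_walk (serves near_nat M) (k + 1) ?us (k + 2)"
    using us(1) unfolding labelled_walk_append by auto
  have fst_us: "set (map fst us) = {..k}"
    using us(2) ts(4) by simp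
  have snd_us: "set ((k + 1) # map snd us) = {..k + 1}"
    using us(3) ts(5) by (metis set_rev)
  have "distinct (map fst us)"
    using us(2) ts(2) by simp
  moreover have "k + 1 \<notin> set (map fst us)"
    unfolding fst_us by simp
  ultimately have labels: "distinct (map fst ?us)"
    by simp
  have "distinct ((k + 1) # map snd us)"
    using us(3) ts(3) by (metis distinct_rev)
  moreover have "k + 2 \<notin> set ((k + 1) # map snd us)"
    unfolding snd_us by simp
  ultimately have vertices: "distinct ((k + 1) # map snd ?us)"
    by simp
  have F: "filter (\<lambda>v. v \<in> M) ((k + 1) # map snd us) = rev (filter (\<lambda>v. v \<in> M) (k # map snd ts))"
    unfolding us(3) rev_filter ..
  have F': "filter (\<lambda>v. v \<in> M) ((k + 1) # map snd ?us) = filter (\<lambda>v. v \<in> M) ((k + 1) # map snd us)"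
    using \<open>k + 2 \<notin> M\<close> by simp
  have "fst ` set ?us = insert (k + 1) (set (map fst us))"
    by simp
  also have "\<dots> = {..Suc k}"
    unfolding fst_us by auto
  finally have labels_eq: "fst ` set ?us = {..Suc k}" .
  have "set ((k + 1) # map snd ?us) = insert (k + 2) (set ((k + 1) # map snd us))"
    by auto
  also have "\<dots> = {..Suc k + 1}"
    unfolding snd_us by auto
  finally have vertices_eq: "set ((k + 1) # map snd ?us) = {..Suc k + 1}" .
  have marks: "filter (\<lambda>v. v \<in> M) ((k + 1) # map snd ?us) \<in> {[0, 1], [1, 0]}"
    unfolding F' F using ts(6) by auto
  show ?case
    using walk labels vertices labels_eq vertices_eq marks
    by (intro exI[of _ ?us]) (simp only: Suc_eq_plus1 add.assoc one_add_one simp_thms)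
qed

text \<open>Two disjoint walks share the left part of the path, one through 0 and one through 1, so
  that the right end can be visited between them. In the induction step the second walk becomes the
  first; the reversed first walk, extended by the jump from \<open>k\<close> to
  \<open>k + 4\<close>, becomes the second. The jump serves its midpoint
  \<open>k + 2\<close>.\<close>

lemma two_paths:
  assumes "k + 5 \<le> D" and M: "M = {0, 1, D - 1, D}"
  shows "\<exists>ts us. labelled_walk (serves near_nat M) k ts (k + 2) \<and>
    labelled_walk (serves near_nat M) (k + 1) us (k + 3) \<and>
    distinct (map fst (ts @ us)) \<and> distinct (k # map snd ts @ (k + 1) # map snd us) \<and>
    fst ` set (ts @ us) = {..k + 1} \<and> set (k # map snd ts @ (k + 1) # map snd us) = {..k + 3} \<and>
    (filter (\<lambda>v. v \<in> M) (k # map snd ts), filter (\<lambda>v. v \<in> M) ((k + 1) # map snd us))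
      \<in> {([0], [1]), ([1], [0])}"
  using assms(1)
proof (induction k)
  case 0
  have "labelled_walk (serves near_nat M) 0 [(0, 2)] 2" "labelled_walk (serves near_nat M) 1 [(1, 3)] 3"
    by (simp_all add: serves_def near_nat_def)
  moreover have "{..(1::nat)} = {0, 1}" "{..(3::nat)} = {0, 2, 1, 3}" by auto
  moreover have "2 \<notin> M" "3 \<notin> M" "0 \<in> M" "1 \<in> M" using 0 by (auto simp: M)
  ultimately show ?case
    by (intro exI[of _ "[(0, 2)]"] exI[of _ "[(1, 3)]"]) simp
next
  case (Suc k)
  then obtain ts us where ts: "labelled_walk (serves near_nat M) k ts (k + 2)"
    "labelled_walk (serves near_nat M) (k + 1) us (k + 3)"
    "distinct (map fst (ts @ us))" "distinct (k # map snd ts @ (k + 1) # map snd us)"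
    "fst ` set (ts @ us) = {..k + 1}" "set (k # map snd ts @ (k + 1) # map snd us) = {..k + 3}"
    "(filter (\<lambda>v. v \<in> M) (k # map snd ts), filter (\<lambda>v. v \<in> M) ((k + 1) # map snd us))
      \<in> {([0], [1]), ([1], [0])}"
    by auto
  obtain rs where rs: "labelled_walk (serves near_nat M) (k + 2) rs k"
    "map fst rs = rev (map fst ts)" "(k + 2) # map snd rs = rev (k # map snd ts)"
    using labelled_walk_rev[OF ts(1) serves_near_nat_sym] by blast
  let ?rs = "rs @ [(k + 2, k + 4)]"
  have nM: "k + 2 \<notin> M" using Suc.prems M by auto
  have k4: "k + 4 \<notin> M" using Suc.prems M by auto
  have "serves near_nat M (k + 2) k (k + 4)"
    using nM by (simp add: serves_def near_nat_def)
  then have w: "labelled_walk (serves near_nat M) (k + 2) ?rs (k + 4)"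
    using rs(1) by (auto simp: labelled_walk_append)
  have fst_rs: "fst ` set rs = fst ` set ts" and d_rs: "distinct (map fst rs)"
    using rs(2) ts(3) by (metis set_rev list.set_map, simp)
  have snd_rs: "set ((k + 2) # map snd rs) = set (k # map snd ts)"
    using rs(3) by (metis set_rev)
  have dv_rs: "distinct ((k + 2) # map snd rs)"
    using rs(3) ts(4) by (metis distinct_rev distinct_append append_Cons)
  have F: "filter (\<lambda>v. v \<in> M) ((k + 2) # map snd rs) = rev (filter (\<lambda>v. v \<in> M) (k # map snd ts))"
    unfolding rs(3) rev_filter ..
  have d1: "distinct (map fst (us @ ?rs))"
  proof -
    have "k + 2 \<notin> fst ` set (ts @ us)" unfolding ts(5) by simp
    then show ?thesis using ts(3) fst_rs d_rs by auto
  qed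
  have s1: "fst ` set (us @ ?rs) = {..Suc k + 1}"
    using ts(5) fst_rs by (auto simp: atMost_Suc image_Un)
  have A: "set ((k + 1) # map snd us) \<inter> set (k # map snd ts) = {}"
    using ts(4) by auto
  have B: "set ((k + 1) # map snd us) \<union> set (k # map snd ts) = {..k + 3}"
    using ts(6) by auto
  have "k + 4 \<notin> set ((k + 1) # map snd us) \<union> set (k # map snd ts)"
    unfolding B by simp
  then have k4': "k + 4 \<notin> set ((k + 1) # map snd us)" "k + 4 \<notin> set ((k + 2) # map snd rs)"
    unfolding snd_rs Un_iff by blast+
  have du: "distinct ((k + 1) # map snd us)" using ts(4) by simp
  have d2: "distinct (((k + 1) # map snd us) @ ((k + 2) # map snd rs) @ [k + 4])"
    using du dv_rs A k4' unfolding distinct_append snd_rs[symmetric] by auto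
  have s2: "set (((k + 1) # map snd us) @ ((k + 2) # map snd rs) @ [k + 4]) = {..Suc k + 3}"
  proof -
    have "{..Suc k + 3} = insert (k + 4) {..k + 3}" by auto
    then show ?thesis using B snd_rs by (metis set_append Un_assoc Un_insert_right list.set(1,2) sup_bot.right_neutral)
  qed
  have F2: "filter (\<lambda>v. v \<in> M) (((k + 2) # map snd rs) @ [k + 4]) = rev (filter (\<lambda>v. v \<in> M) (k # map snd ts))"
    unfolding filter_append F using k4 by simp
  have eqs: "Suc k = k + 1" "k + 1 + 2 = k + 3" "k + 1 + 1 = k + 2" "k + 1 + 3 = k + 4" by simp_all
  have F3: "(filter (\<lambda>v. v \<in> M) ((k + 1) # map snd us), filter (\<lambda>v. v \<in> M) ((k + 2) # map snd ?rs))
      \<in> {([0], [1]), ([1], [0])}"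
    using ts(7) F2 unfolding list.map map_append snd_conv append_Cons by auto
  have d3: "distinct ((k + 1) # map snd us @ (k + 2) # map snd ?rs)"
    using d2 by simp
  have s3: "set ((k + 1) # map snd us @ (k + 2) # map snd ?rs) = {..k + 4}"
    using s2 unfolding eqs by simp
  have "labelled_walk (serves near_nat M) (Suc k) us (Suc k + 2)"
    "labelled_walk (serves near_nat M) (Suc k + 1) ?rs (Suc k + 3)"
    unfolding eqs by (rule ts(2), rule w)
  moreover note d1
  moreover have "distinct (Suc k # map snd us @ (Suc k + 1) # map snd ?rs)"
    using d3 unfolding eqs .
  moreover note s1
  moreover have "set (Suc k # map snd us @ (Suc k + 1) # map snd ?rs) = {..Suc k + 3}"
    using s3 unfolding eqs .
  moreover have "(filter (\<lambda>v. v \<in> M) (Suc k # map snd us),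
      filter (\<lambda>v. v \<in> M) ((Suc k + 1) # map snd ?rs)) \<in> {([0], [1]), ([1], [0])}"
    using F3 unfolding eqs .
  ultimately show ?case by blast
qed

lemma dihedral_rev:
  assumes "dihedral vs ys"
  shows "dihedral vs (rev ys)"
proof -
  have "rev (rotate j xs) = rotate (length xs - j mod length xs) (rev xs)" for j and xs :: "'a list"
    using rotate_rev[of "length xs - j mod length xs" xs] rotate_conv_mod[of j xs]
    by (cases "xs = []"; cases "j mod length xs = 0") auto
  with assms show ?thesis
    unfolding dihedral_def by (metis rev_rev_ident)
qed

lemma dihedral_swap: "dihedral vs [a, b, c, d] \<Longrightarrow> dihedral vs [b, a, d, c]"
  using dihedral_rev[of vs "[a, b, c, d]"] dihedral_append_commute[of vs "[d, c]" "[b, a]"] by simp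

lemma path_labelled_cycle:
  assumes "4 \<le> D" "distinct vs" "length vs = 4" "set vs = {0, 1, D - 1, D}"
  shows "\<exists>ts. labelled_cycle near_nat {..D} (set vs) vs ts"
proof -
  let ?M = "{0, 1, D - 1, D}"
  \<comment> \<open>The orders in which 0 and 1 are adjacent: the zigzag is closed up through the
    last two vertices of the path.\<close>
  have adj: ?thesis if cyc: "dihedral vs [0, 1, D, D - 1] \<or> dihedral vs [0, 1, D - 1, D]"
  proof -
    define k where "k = D - 3"
    have D: "D = k + 3" "1 \<le> k" using assms(1) by (auto simp: k_def)
    obtain ts where ts: "labelled_walk (serves near_nat ?M) k ts (k + 1)"
      "distinct (map fst ts)" "distinct (k # map snd ts)" "fst ` set ts = {..k}"
      "set (k # map snd ts) = {..k + 1}"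
      "filter (\<lambda>v. v \<in> ?M) (k # map snd ts) \<in> {[0, 1], [1, 0]}"
      using zigzag_path[of k D ?M] D by auto
    \<comment> \<open>\<open>as\<close> and \<open>bs\<close> visit \<open>D\<close> and
      \<open>D - 1\<close> in opposite orders; one of them is right, whichever of 0 and 1 the zigzag
      meets first. The return to \<open>k\<close> gets the free label \<open>k + 1\<close>.\<close>
    define as where "as = ts @ [(k + 3, k + 3), (k + 2, k + 2), (k + 1, k)]"
    define bs where "bs = ts @ [(k + 2, k + 2), (k + 3, k + 3), (k + 1, k)]"
    have M: "?M = {0, 1, k + 2, k + 3}" using D by auto
    have nM: "k + 1 \<notin> ?M" using D by auto
    have wa: "labelled_walk (serves near_nat ?M) k as k"
      unfolding as_def labelled_walk_append
      using ts(1) nM D(2) by (intro exI[of _ "k + 1"]) (auto simp: serves_def near_nat_def)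
    have wb: "labelled_walk (serves near_nat ?M) k bs k"
      unfolding bs_def labelled_walk_append
      using ts(1) nM D(2) by (intro exI[of _ "k + 1"]) (auto simp: serves_def near_nat_def)
    have d: "distinct (map fst as)" "distinct (map fst bs)"
    proof -
      have "k + 1 \<notin> fst ` set ts" "k + 2 \<notin> fst ` set ts" "k + 3 \<notin> fst ` set ts"
        unfolding ts(4) by auto
      then show "distinct (map fst as)" "distinct (map fst bs)"
        using ts(2) unfolding as_def bs_def by auto
    qed
    have atm: "{..D} = insert (k + 3) (insert (k + 2) (insert (k + 1) {..k}))"
        "{..D} = insert (k + 3) (insert (k + 2) {..k + 1})"
      using D by auto
    have s: "fst ` set as = {..D}" "fst ` set bs = {..D}"
      using ts(4) unfolding atm(1) as_def bs_def by auto
    have "k + 2 \<notin> set (k # map snd ts)" "k + 3 \<notin> set (k # map snd ts)"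
      unfolding ts(5) by auto
    then have d': "distinct (map snd as)" "distinct (map snd bs)"
      using ts(3) unfolding as_def bs_def by auto
    have s': "snd ` set as = {..D}" "snd ` set bs = {..D}"
      using ts(5) unfolding atm(2) as_def bs_def by auto
    let ?F = "filter (\<lambda>v. v \<in> set vs)"
    \<comment> \<open>The start \<open>k\<close> stands last in \<open>map snd as\<close> and
      \<open>map snd bs\<close>; splitting off \<open>?F [k]\<close> allows it to be rotated back to
      the front.\<close>
    have F: "?F (map snd as) = (?F (map snd ts) @ [k + 3, k + 2]) @ ?F [k]"
      "?F (map snd bs) = (?F (map snd ts) @ [k + 2, k + 3]) @ ?F [k]"
      "?F (k # map snd ts) = ?F [k] @ ?F (map snd ts)"
      unfolding as_def bs_def assms(4) M using D(2) by simp_all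
    have "dihedral vs (?F (k # map snd ts) @ [k + 3, k + 2]) \<or>
        dihedral vs (?F (k # map snd ts) @ [k + 2, k + 3])"
    proof -
      have D': "D = k + 3" "D - 1 = k + 2" using D by auto
      from ts(6) have F: "?F (k # map snd ts) = [0, 1] \<or> ?F (k # map snd ts) = [1, 0]"
        unfolding assms(4) by blast
      show ?thesis
        using cyc F dihedral_swap[of vs 0 1] unfolding D' by auto
    qed
    then have "dihedral vs (?F (map snd as)) \<or> dihedral vs (?F (map snd bs))"
      unfolding F using dihedral_append_commute[of vs "?F [k]"] by (metis append_assoc)
    then have "labelled_cycle near_nat {..D} (set vs) vs as \<or>
        labelled_cycle near_nat {..D} (set vs) vs bs"
      unfolding labelled_cycle_def assms(4) using wa wb d s d' s' by blast
    then show ?thesis by blast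
  qed
  \<comment> \<open>The order in which 0 and 1 are opposite: two walks on the left are joined
    through \<open>D\<close> and through \<open>D - 1\<close>. There is room for them if
    \<open>D\<close> is at least 5; for \<open>D = 4\<close> a cycle is given outright.\<close>
  have inter: ?thesis if cyc: "dihedral vs [0, D - 1, 1, D]"
  proof (cases "D = 4")
    case True
    let ?ts = "[(3, 3), (1, 1), (2, 4), (4, 2), (0, 0)] :: (nat \<times> nat) list"
    have "labelled_walk (serves near_nat (set vs)) 0 ?ts 0"
      by (auto simp: serves_def near_nat_def assms(4) True)
    moreover have "{..D} = {0, 1, 2, 3, 4}" using True by auto
    moreover have "dihedral vs [3, 1, 4, 0]"
      using dihedral_append_commute[of vs "[0]" "[3, 1, 4]"] cyc True by simp
    then have "dihedral vs (filter (\<lambda>v. v \<in> set vs) (map snd ?ts))"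
      using True by (simp add: assms(4))
    ultimately have "labelled_cycle near_nat {..D} (set vs) vs ?ts"
      unfolding labelled_cycle_def by auto
    then show ?thesis by blast
  next
    case False
    define k where "k = D - 5"
    have D: "D = k + 5" using assms(1) False by (auto simp: k_def)
    obtain ts us where ts: "labelled_walk (serves near_nat ?M) k ts (k + 2)"
      "labelled_walk (serves near_nat ?M) (k + 1) us (k + 3)"
      "distinct (map fst (ts @ us))" "distinct (k # map snd ts @ (k + 1) # map snd us)"
      "fst ` set (ts @ us) = {..k + 1}" "set (k # map snd ts @ (k + 1) # map snd us) = {..k + 3}"
      "(filter (\<lambda>v. v \<in> ?M) (k # map snd ts), filter (\<lambda>v. v \<in> ?M) ((k + 1) # map snd us))
        \<in> {([0], [1]), ([1], [0])}"
      using two_paths[of k D ?M] D by auto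
    \<comment> \<open>One link goes from \<open>k + 2\<close> over \<open>k + 5\<close> to
      \<open>k + 1\<close>, the other from \<open>k + 3\<close> over \<open>k + 4\<close> back to
      \<open>k\<close>. Their edges of length 4 serve their midpoints \<open>k + 3\<close> and
      \<open>k + 2\<close>.\<close>
    define as where "as = ts @ [(k + 5, k + 5), (k + 3, k + 1)] @ us @ [(k + 4, k + 4), (k + 2, k)]"
    have M: "?M = {0, 1, k + 4, k + 5}" using D by auto
    have nM: "k + 3 \<notin> ?M" "k + 2 \<notin> ?M" using D by auto
    have w: "labelled_walk (serves near_nat ?M) k as k"
      unfolding as_def labelled_walk_append using ts(1,2) nM
      by (intro exI[of _ "k + 2"] conjI exI[of _ "k + 1"] exI[of _ "k + 3"])
        (auto simp: serves_def near_nat_def)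
    have "k + 2 \<notin> fst ` set (ts @ us)" "k + 3 \<notin> fst ` set (ts @ us)"
      "k + 4 \<notin> fst ` set (ts @ us)" "k + 5 \<notin> fst ` set (ts @ us)"
      unfolding ts(5) by auto
    then have d: "distinct (map fst as)"
      using ts(3) unfolding as_def by auto
    have "{..D} = insert (k + 5) (insert (k + 4) (insert (k + 3) (insert (k + 2) {..k + 1})))"
      using D by auto
    then have s: "fst ` set as = {..D}"
      using ts(5) unfolding as_def by auto
    have "k + 4 \<notin> set (k # map snd ts @ (k + 1) # map snd us)"
      "k + 5 \<notin> set (k # map snd ts @ (k + 1) # map snd us)"
      unfolding ts(6) by auto
    then have d': "distinct (map snd as)"
      using ts(4) unfolding as_def by auto
    have "{..D} = insert (k + 5) (insert (k + 4) {..k + 3})"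
      using D by auto
    then have s': "snd ` set as = {..D}"
      using ts(6) unfolding as_def by auto
    let ?F = "filter (\<lambda>v. v \<in> set vs)"
    have Fa: "?F (map snd as) =
        (?F (map snd ts) @ [k + 5] @ ?F ((k + 1) # map snd us) @ [k + 4]) @ ?F [k]"
      unfolding as_def assms(4) M by simp
    have "dihedral vs (?F (k # map snd ts) @ [k + 5] @ ?F ((k + 1) # map snd us) @ [k + 4])"
    proof -
      have D': "D = k + 5" "k + 5 - 1 = k + 4" using D by auto
      from ts(7) have F: "?F (k # map snd ts) = [0] \<and> ?F ((k + 1) # map snd us) = [1] \<or>
          ?F (k # map snd ts) = [1] \<and> ?F ((k + 1) # map snd us) = [0]"
        unfolding assms(4) by blast
      have "dihedral vs [1, D, 0, D - 1]"
        using dihedral_append_commute[of vs "[0, D - 1]" "[1, D]"] cyc by simp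
      moreover from this have "dihedral vs [0, D, 1, D - 1]"
        using dihedral_append_commute[of vs "[D, 1, D - 1]" "[0]"] dihedral_swap[of vs 1 D 0 "D - 1"] by simp
      ultimately show ?thesis
        using F unfolding D' by auto
    qed
    moreover have "?F (k # map snd ts) = ?F [k] @ ?F (map snd ts)"
      by simp
    ultimately have "dihedral vs (?F (map snd as))"
      unfolding Fa using dihedral_append_commute[of vs "?F [k]"] by (metis append_assoc)
    then have "labelled_cycle near_nat {..D} (set vs) vs as"
      unfolding labelled_cycle_def assms(4) using w d s d' s' by blast
    then show ?thesis by blast
  qed
  from assms(2,3,4) show ?thesis
    by (rule dihedral_cases) (use adj inter in blast)+
qed

section \<open>Distances and connectivity inside a vertex set\<close>

text \<open>Distances are measured inside \<open>S\<close> because the inductions delete vertices.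
  The reflexive closure makes the \<open>k\<close>-th power mean at most \<open>k\<close>
  edges.\<close>

definition near :: "('a \<times> 'a) set \<Rightarrow> 'a set \<Rightarrow> nat \<Rightarrow> 'a \<Rightarrow> 'a \<Rightarrow> bool" where
  "near E S k x y \<longleftrightarrow> (x, y) \<in> ((Restr E S)\<^sup>=) ^^ k"

lemma near_refl: "near E S k x x"
  unfolding near_def by (induction k) auto

lemma near_edge: "(x, y) \<in> E \<Longrightarrow> x \<in> S \<Longrightarrow> y \<in> S \<Longrightarrow> near E S 1 x y"
  unfolding near_def by auto

lemma near_trans: "near E S k x y \<Longrightarrow> near E S l y z \<Longrightarrow> near E S (k + l) x z"
  unfolding near_def relpow_add by blast

lemma near_mono: "near E S k x y \<Longrightarrow> k \<le> l \<Longrightarrow> near E S l x y"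
  using near_trans[of E S k x y "l - k" y] near_refl[of E S "l - k" y] by simp

lemma near_mono_set:
  assumes "near E S k x y" "S \<subseteq> T"
  shows "near E T k x y"
  using assms(1) unfolding near_def
proof (induction k arbitrary: y)
  case (Suc k)
  then obtain z where "(x, z) \<in> ((Restr E S)\<^sup>=) ^^ k" "(z, y) \<in> (Restr E S)\<^sup>="
    by auto
  moreover from this(2) have "(z, y) \<in> (Restr E T)\<^sup>="
    using assms(2) by auto
  ultimately show ?case
    using Suc.IH relpow_Suc_I by metis
qed simp

lemma near_sym:
  assumes "sym E" "near E S k x y"
  shows "near E S k y x"
  using assms(2)
proof (induction k arbitrary: y)
  case 0
  then show ?case by (simp add: near_def)
next
  case (Suc k)
  then obtain z where z: "near E S k x z" "(z, y) \<in> (Restr E S)\<^sup>="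
    unfolding near_def by auto
  then have "near E S 1 y z"
    using assms(1) unfolding near_def by (auto dest: symD)
  then show ?case
    using near_trans[of E S 1 y z k x] Suc.IH[OF z(1)] by simp
qed

definition connected_on :: "('a \<times> 'a) set \<Rightarrow> 'a set \<Rightarrow> bool" where
  "connected_on E S \<longleftrightarrow> (\<forall>x\<in>S. \<forall>y\<in>S. (x, y) \<in> (Restr E S)\<^sup>*)"

lemma connected_onI:
  assumes "sym E" and "\<And>x. x \<in> S \<Longrightarrow> (a, x) \<in> (Restr E S)\<^sup>*"
  shows "connected_on E S"
proof -
  have "sym ((Restr E S)\<^sup>*)"
    using assms(1) by (intro sym_rtrancl) (auto simp: sym_def)
  then show ?thesis
    unfolding connected_on_def using assms(2) by (meson rtrancl_trans symD)
qed

lemma connected_on_exit: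
  assumes "connected_on E S" "x \<in> T" "y \<in> S - T" "T \<subseteq> S"
  obtains a b where "a \<in> T" "b \<in> S - T" "(a, b) \<in> E"
proof -
  have "(x, y) \<in> (Restr E S)\<^sup>*"
    using assms unfolding connected_on_def by blast
  then have "y \<in> T \<or> (\<exists>a b. a \<in> T \<and> b \<in> S - T \<and> (a, b) \<in> E)"
    using assms(2) by (induction rule: rtrancl_induct) auto
  with assms(3) that show thesis by blast
qed

lemma connected_on_insert:
  assumes "sym E" "connected_on E T" "a \<in> T" "(a, b) \<in> E"
  shows "connected_on E (insert b T)"
proof (rule connected_onI[OF assms(1)])
  have mono: "(Restr E T)\<^sup>* \<subseteq> (Restr E (insert b T))\<^sup>*"
    by (intro rtrancl_mono) auto
  fix x assume "x \<in> insert b T"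
  then show "(a, x) \<in> (Restr E (insert b T))\<^sup>*"
  proof
    assume "x = b"
    with assms(3,4) show ?thesis by (intro r_into_rtrancl) auto
  next
    assume "x \<in> T"
    with assms(2,3) mono show ?thesis unfolding connected_on_def by blast
  qed
qed

text \<open>Grow \<open>T\<close> by adjacent vertices; the last vertex added is not a cut vertex of \<open>S\<close>.\<close>

lemma exists_non_cut_vertex:
  assumes "sym E" "finite S" "connected_on E S"
    and "T \<subset> S" "T \<noteq> {}" "connected_on E T"
  obtains z where "z \<in> S - T" "connected_on E (S - {z})"
proof -
  have "\<exists>z\<in>S - T. connected_on E (S - {z})"
    using assms(4,5,6)
  proof (induction "card (S - T)" arbitrary: T rule: less_induct)
    case less
    then obtain x y where "x \<in> T" "y \<in> S - T" by blast
    with less.prems assms(3) obtain a b where ab: "a \<in> T" "b \<in> S - T" "(a, b) \<in> E"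
      by (meson connected_on_exit psubset_imp_subset)
    have conn: "connected_on E (insert b T)"
      using connected_on_insert[OF assms(1) less.prems(3) ab(1,3)] .
    show ?case
    proof (cases "insert b T = S")
      case True
      then have "S - {b} = T" using ab(2) by blast
      with ab(2) less.prems(3) show ?thesis by blast
    next
      case False
      have "card (S - insert b T) < card (S - T)"
        using ab(2) assms(2) by (intro psubset_card_mono) auto
      then show ?thesis
        using less.hyps[of "insert b T"] conn False ab(2) less.prems(1) by blast
    qed
  qed
  with that show thesis by blast
qed

lemma connected_on_ball:
  assumes "sym E" "a \<in> S"
  shows "connected_on E {w \<in> S. near E S k a w}"
proof (rule connected_onI[OF assms(1)])
  let ?B = "\<lambda>k. {w \<in> S. near E S k a w}"
  fix w assume "w \<in> ?B k"
  then show "(a, w) \<in> (Restr E (?B k))\<^sup>*"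
  proof (induction k arbitrary: w)
    case 0
    then show ?case by (simp add: near_def)
  next
    case (Suc k)
    then obtain v where v: "near E S k a v" "(v, w) \<in> (Restr E S)\<^sup>="
      unfolding near_def by auto
    have sub: "?B k \<subseteq> ?B (Suc k)"
      using near_mono[of E S k a _ "Suc k"] by auto
    have vS: "v \<in> S" using v(2) Suc.prems by auto
    with Suc.IH v(1) have "(a, v) \<in> (Restr E (?B k))\<^sup>*" by blast
    then have "(a, v) \<in> (Restr E (?B (Suc k)))\<^sup>*"
      using rtrancl_mono[of "Restr E (?B k)" "Restr E (?B (Suc k))"] sub by blast
    moreover have "(v, w) \<in> (Restr E (?B (Suc k)))\<^sup>="
      using v vS sub Suc.prems by auto
    ultimately show ?case by (auto intro: rtrancl_into_rtrancl)
  qed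
qed

text \<open>The ball of radius \<open>k\<close> around \<open>a\<close> is connected and misses
  \<open>b\<close>, so growing it by \<open>exists_non_cut_vertex\<close> gives a non-cut vertex
  outside it.\<close>

lemma exists_distant_non_cut_vertex:
  assumes "sym E" "finite S" "connected_on E S" "a \<in> S" "b \<in> S" "\<not> near E S k a b"
  obtains z where "z \<in> S" "connected_on E (S - {z})" "\<not> near E S k a z"
proof -
  let ?B = "{w \<in> S. near E S k a w}"
  have "a \<in> ?B" using assms(4) near_refl[of E S k a] by simp
  moreover have "?B \<subset> S" using assms(5,6) by auto
  ultimately obtain z where "z \<in> S - ?B" "connected_on E (S - {z})"
    using exists_non_cut_vertex[OF assms(1-3) _ _ connected_on_ball[OF assms(1,4)]] by blast
  with that show thesis by blast
qed

lemma rtrancl_distinct_path: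
  assumes "(x, y) \<in> R\<^sup>*"
  obtains p where "p \<noteq> []" "hd p = x" "last p = y" "distinct p" "successively (\<lambda>a b. (a, b) \<in> R) p"
proof -
  have "\<exists>p. p \<noteq> [] \<and> hd p = x \<and> last p = y \<and> distinct p \<and> successively (\<lambda>a b. (a, b) \<in> R) p"
    using assms
  proof (induction rule: converse_rtrancl_induct)
    case base
    show ?case by (intro exI[of _ "[y]"]) simp
  next
    case (step x z)
    then obtain p where p: "p \<noteq> []" "hd p = z" "last p = y" "distinct p"
      "successively (\<lambda>a b. (a, b) \<in> R) p" by blast
    show ?case
    proof (cases "x \<in> set p")
      case True
      then obtain as bs where "p = as @ x # bs" by (meson split_list)
      with p show ?thesis
        by (intro exI[of _ "x # bs"]) (auto simp: successively_append_iff)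
    next
      case False
      with p step(1) show ?thesis
        by (intro exI[of _ "x # p"]) (auto simp: successively_Cons)
    qed
  qed
  with that show thesis by blast
qed

lemma successively_near:
  assumes "successively (\<lambda>a b. (a, b) \<in> Restr E S) p" "i + k < length p"
  shows "near E S k (p ! i) (p ! (i + k))"
  using assms(2)
proof (induction k)
  case 0
  then show ?case by (simp add: near_def)
next
  case (Suc k)
  have "(p ! (i + k), p ! Suc (i + k)) \<in> Restr E S"
    using assms(1) Suc.prems by (simp add: successively_conv_nth)
  then have "near E S 1 (p ! (i + k)) (p ! Suc (i + k))"
    by (intro near_edge) auto
  with Suc show ?case
    using near_trans[of E S k "p ! i" "p ! (i + k)" 1] by simp
qed

section \<open>Labelled cycles in graphs\<close>

text \<open>Carries the cycle found on a numbered path over to the graph, along a map that does not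
  increase distances. Injectivity keeps labels and vertices distinct and ensures that no further
  label falls under the stronger condition.\<close>

lemma labelled_cycle_map:
  assumes "labelled_cycle N A (set vs) vs ts" "A \<noteq> {}" "inj_on f A" "set vs \<subseteq> A"
    and "\<And>k i j. i \<in> A \<Longrightarrow> j \<in> A \<Longrightarrow> N k i j \<Longrightarrow> N' k (f i) (f j)"
  shows "labelled_cycle N' (f ` A) (set (map f vs)) (map f vs) (map (map_prod f f) ts)"
proof -
  obtain x where x: "labelled_walk (serves N (set vs)) x ts x"
    and ts: "distinct (map fst ts)" "distinct (map snd ts)" "fst ` set ts = A" "snd ` set ts = A"
    "dihedral vs (filter (\<lambda>v. v \<in> set vs) (map snd ts))"
    using assms(1) unfolding labelled_cycle_def by blast
  have fs: "map fst (map (map_prod f f) ts) = map f (map fst ts)"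
    "map snd (map (map_prod f f) ts) = map f (map snd ts)"
    by simp_all
  \<comment> \<open>The start of a closed walk with at least one step is also its last vertex, and
    so it lies in \<open>A\<close>.\<close>
  have "ts \<noteq> []" using ts(3) assms(2) by auto
  then have "x \<in> set (map snd ts)"
    using labelled_walk_last[OF x] last_in_set[of "map snd ts"] by auto
  then have "x \<in> A" using ts(4) by simp
  moreover have "serves N' (set (map f vs)) (f w) (f a) (f b)"
    if "w \<in> A" "a \<in> A" "b \<in> A" "serves N (set vs) w a b" for w a b
  proof -
    have "w \<in> set vs" if "f w \<in> set (map f vs)"
      using that assms(3,4) \<open>w \<in> A\<close> by (auto simp: inj_on_eq_iff)
    then show ?thesis
      using that assms(5) unfolding serves_def by blast
  qed
  ultimately have "labelled_walk (serves N' (set (map f vs))) (f x) (map (map_prod f f) ts) (f x)"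
    using ts(3,4) by (intro labelled_walk_map[OF x, of A A]) auto
  moreover have "distinct (map fst (map (map_prod f f) ts))" "distinct (map snd (map (map_prod f f) ts))"
    unfolding fs distinct_map[of f] using ts assms(3) by auto
  moreover have "fst ` set (map (map_prod f f) ts) = f ` A" "snd ` set (map (map_prod f f) ts) = f ` A"
    unfolding list.set_map[symmetric] fs unfolding list.set_map ts by simp_all
  moreover have "filter (\<lambda>v. v \<in> set (map f vs)) (map f (map snd ts)) =
      map f (filter (\<lambda>v. v \<in> set vs) (map snd ts))"
  proof -
    have "filter (\<lambda>v. f v \<in> set (map f vs)) ys = filter (\<lambda>v. v \<in> set vs) ys" if "set ys = A" for ys
      using assms(3,4) that by (intro filter_cong) (auto simp: inj_on_eq_iff subset_iff)
    then show ?thesis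
      using ts(4) unfolding filter_map[of _ f] comp_def by (metis list.set_map)
  qed
  ultimately show ?thesis
    unfolding labelled_cycle_def fs using dihedral_map[OF ts(5), of f] by auto
qed

text \<open>The prescribed vertices are listed first, in the given order. Every edge has length at
  most 3 and is labelled by the end it leads to.\<close>

lemma labelled_cycle_of_diameter_3:
  assumes "sym E" "finite S" "S \<noteq> {}" "distinct vs" "set vs \<subseteq> S"
    and "\<And>x y. x \<in> S \<Longrightarrow> y \<in> S \<Longrightarrow> near E S 3 x y"
  shows "\<exists>ts. labelled_cycle (near E S) S (set vs) vs ts"
proof -
  obtain ys where ys: "set ys = S - set vs" "distinct ys"
    using finite_distinct_list[of "S - set vs"] assms(2) by auto
  define xs where "xs = vs @ ys"
  let ?ts = "map (\<lambda>v. (v, v)) xs"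
  have xs: "set xs = S" "distinct xs" using ys assms(4,5) by (auto simp: xs_def)
  then have "xs \<noteq> []" using assms(3) by auto
  have "serves (near E S) (set vs) v a v" if "v \<in> S" "a \<in> S" for v a
    unfolding serves_def using that assms(6) near_refl[of E S 2 v] near_mono[of E S 3 a v 4] by auto
  then have "labelled_walk (serves (near E S) (set vs)) (last xs) ?ts (last (last xs # xs))"
    using xs last_in_set[OF \<open>xs \<noteq> []\<close>] by (intro labelled_walk_diag[of S]) auto
  moreover have "filter (\<lambda>v. v \<in> set vs) xs = vs"
    using ys unfolding xs_def by (simp add: filter_empty_conv)
  ultimately have "labelled_cycle (near E S) S (set vs) vs ?ts"
    using xs \<open>xs \<noteq> []\<close> dihedral_refl[of vs]
    unfolding labelled_cycle_def by (auto simp: comp_def image_image)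
  then show ?thesis by blast
qed

lemma connected_on_path:
  assumes "sym E" "p \<noteq> []" "successively (\<lambda>a b. (a, b) \<in> E) p"
  shows "connected_on E (set p)"
proof (rule connected_onI[OF assms(1)])
  have *: "successively (\<lambda>a b. (a, b) \<in> Restr E (set p)) p"
    using assms(3) by (auto simp: successively_conv_nth)
  fix x assume "x \<in> set p"
  then obtain k where k: "k < length p" "x = p ! k" by (auto simp: in_set_conv_nth)
  then have "near E (set p) k (p ! 0) x"
    using successively_near[OF *, of 0 k] by simp
  then show "(p ! 0, x) \<in> (Restr E (set p))\<^sup>*"
    unfolding near_def by (metis relpow_imp_rtrancl rtrancl_reflcl)
qed

text \<open>If some distance exceeds 3, then so does the distance of two suitable non-cut vertices
  \<open>x\<close> and \<open>y\<close>. On a path between them the first two and the last two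
  vertices are non-cut vertices and neighbours of such, hence exactly the four prescribed ones. If
  the path missed a vertex, there would be a non-cut vertex off the path, and it would be prescribed
  too; so the path spans \<open>S\<close>.\<close>

lemma labelled_cycle_base:
  assumes "sym E" "finite S" "connected_on E S"
    and vs: "distinct vs" "length vs = 4" "set vs \<subseteq> S"
    and marked: "\<And>l. l \<in> S \<Longrightarrow> connected_on E (S - {l}) \<Longrightarrow> l \<in> set vs"
    and nbrs: "\<And>l u. l \<in> S \<Longrightarrow> connected_on E (S - {l}) \<Longrightarrow> u \<in> S \<Longrightarrow> (l, u) \<in> E \<Longrightarrow> u \<in> set vs"
  shows "\<exists>ts. labelled_cycle (near E S) S (set vs) vs ts"
proof (cases "\<forall>x\<in>S. \<forall>y\<in>S. near E S 3 x y")
  case True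
  have "S \<noteq> {}" using vs by auto
  with True show ?thesis
    using labelled_cycle_of_diameter_3[OF assms(1,2) _ vs(1,3)] by blast
next
  case False
  then obtain a b where "a \<in> S" "b \<in> S" "\<not> near E S 3 a b" by blast
  then obtain x where x: "x \<in> S" "connected_on E (S - {x})" "\<not> near E S 3 a x"
    by (rule exists_distant_non_cut_vertex[OF assms(1-3)])
  then have "\<not> near E S 3 x a" using near_sym[OF assms(1)] by blast
  then obtain y where y: "y \<in> S" "connected_on E (S - {y})" "\<not> near E S 3 x y"
    by (rule exists_distant_non_cut_vertex[OF assms(1-3) x(1) \<open>a \<in> S\<close>])
  have "(x, y) \<in> (Restr E S)\<^sup>*" using assms(3) x(1) y(1) unfolding connected_on_def by blast
  then obtain p where p: "p \<noteq> []" "hd p = x" "last p = y" "distinct p"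
    "successively (\<lambda>a b. (a, b) \<in> Restr E S) p"
    by (rule rtrancl_distinct_path)
  define D where "D = length p - 1"
  have len: "length p = Suc D" using p(1) by (simp add: D_def)
  have ends: "p ! 0 = x" "p ! D = y"
    using p(1-3) by (simp_all add: D_def hd_conv_nth last_conv_nth)
  \<comment> \<open>The path may be any one from \<open>x\<close> to \<open>y\<close>: index
    differences bound distances from above, which is what the transport from \<open>near_nat\<close>
    asks for.\<close>
  have dist: "near E S (j - i) (p ! i) (p ! j)" if "i \<le> j" "j \<le> D" for i j
    using successively_near[OF p(5), of i "j - i"] that len by simp
  have "4 \<le> D"
  proof (rule ccontr)
    assume "\<not> 4 \<le> D"
    then have "near E S 3 x y"
      using dist[of 0 D] ends by (intro near_mono[of E S D x y 3]) auto
    with y(3) show False by blast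
  qed
  have step: "(p ! i, p ! Suc i) \<in> Restr E S" if "i < D" for i
    using p(5) that len by (simp add: successively_conv_nth)
  have inj: "inj_on ((!) p) {..D}"
    using p(4) len by (auto simp: inj_on_def nth_eq_iff_index_eq)
  have img: "(!) p ` {..D} = set p"
    using len by (auto simp: set_conv_nth less_Suc_eq_le)
  have sub: "set p \<subseteq> S"
  proof
    fix v assume "v \<in> set p"
    then obtain i where i: "i \<le> D" "v = p ! i" unfolding img[symmetric] by blast
    show "v \<in> S"
      using step[of i] step[of "i - 1"] i \<open>4 \<le> D\<close> by (cases "i = D") auto
  qed
  let ?A = "{0, 1, D - 1, D}"
  have "(p ! 0, p ! 1) \<in> Restr E S" using step[of 0] \<open>4 \<le> D\<close> by simp
  moreover have "(p ! (D - 1), p ! D) \<in> Restr E S" using step[of "D - 1"] \<open>4 \<le> D\<close> by simp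
  then have "(p ! D, p ! (D - 1)) \<in> Restr E S" using assms(1) by (auto dest: symD)
  ultimately have "p ! 0 \<in> set vs" "p ! 1 \<in> set vs" "p ! (D - 1) \<in> set vs" "p ! D \<in> set vs"
    using marked[OF x(1,2)] marked[OF y(1,2)] nbrs[OF x(1,2)] nbrs[OF y(1,2)] unfolding ends by auto
  then have sub_vs: "(!) p ` ?A \<subseteq> set vs" by blast
  have A: "?A \<subseteq> {..D}" using \<open>4 \<le> D\<close> by auto
  have "card ?A = 4" using \<open>4 \<le> D\<close> by auto
  then have "card ((!) p ` ?A) = 4"
    using card_image[OF inj_on_subset[OF inj A]] by simp
  then have "card (set vs) \<le> card ((!) p ` ?A)"
    using distinct_card[OF vs(1)] vs(2) by presburger
  then have img_A: "(!) p ` ?A = set vs"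
    using sub_vs by (intro card_seteq) auto
  have "set p = S"
  proof (rule ccontr)
    assume "set p \<noteq> S"
    moreover have "connected_on E (set p)"
    proof (rule connected_on_path[OF assms(1) p(1)])
      show "successively (\<lambda>a b. (a, b) \<in> E) p"
        using p(5) by (rule successively_mono) auto
    qed
    ultimately obtain z where "z \<in> S - set p" "connected_on E (S - {z})"
      using exists_non_cut_vertex[OF assms(1-3), of "set p"] sub p(1) by auto
    moreover from this have "z \<in> (!) p ` ?A"
      unfolding img_A by (intro marked) auto
    ultimately show False using A img by blast
  qed
  \<comment> \<open>The prescribed list is pulled back to a list of indices, to which
    \<open>path_labelled_cycle\<close> applies.\<close>
  have "vs \<in> lists ((!) p ` ?A)"
    unfolding img_A by auto
  then obtain js where js: "vs = map ((!) p) js" "set js \<subseteq> ?A"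
    unfolding lists_image by (auto simp: in_lists_conv_set)
  have js_D: "set js \<subseteq> {..D}"
    using js(2) A by (rule subset_trans)
  have "(!) p ` set js = (!) p ` ?A"
    unfolding img_A js(1) by simp
  then have "set js = ?A"
    using inj_on_image_eq_iff[OF inj js_D A] by blast
  moreover have "distinct js" "length js = 4"
    using vs(1,2) unfolding js(1) by (simp_all add: distinct_map)
  ultimately obtain ts where ts: "labelled_cycle near_nat {..D} (set js) js ts"
    using path_labelled_cycle[OF \<open>4 \<le> D\<close>, of js] by blast
  have "near E S k (p ! i) (p ! j)" if "i \<in> {..D}" "j \<in> {..D}" "near_nat k i j" for k i j
  proof (cases "i \<le> j")
    case True
    then show ?thesis using dist[of i j] that by (auto simp: near_nat_def intro: near_mono)
  next
    case False
    then have "near E S (i - j) (p ! j) (p ! i)" using dist[of j i] that by simp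
    then have "near E S (i - j) (p ! i) (p ! j)" by (rule near_sym[OF assms(1)])
    moreover have "i - j \<le> k" using that(3) by (auto simp: near_nat_def)
    ultimately show ?thesis by (rule near_mono)
  qed
  then have "labelled_cycle (near E S) ((!) p ` {..D}) (set (map ((!) p) js)) (map ((!) p) js)
      (map (map_prod ((!) p) ((!) p)) ts)"
    using js_D by (intro labelled_cycle_map[OF ts _ inj]) auto
  then show ?thesis
    unfolding img \<open>set p = S\<close> js(1)[symmetric] by blast
qed

section \<open>Inserting a vertex into a labelled cycle, and the two inductions on the number of
  vertices\<close>

lemma labelled_cycle_splice:
  assumes "labelled_cycle N T M vs (bs @ [(u, z)])" "l \<notin> T" "{a, b} = {u, l}"
    and "labelled_walk (serves N' M') z bs p" "serves N' M' a p l" "serves N' M' b l z"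
    and "dihedral vs' (filter (\<lambda>v. v \<in> set vs') (map snd bs @ [l, z]))"
  shows "labelled_cycle N' (insert l T) M' vs' (bs @ [(a, l), (b, z)])"
proof -
  have "labelled_walk (serves N' M') z (bs @ [(a, l), (b, z)]) z"
    unfolding labelled_walk_append using assms(4-6) by auto
  moreover have "u \<in> T" "z \<in> T"
    using assms(1) unfolding labelled_cycle_def by auto
  ultimately show ?thesis
    using assms(1,2,3,7) unfolding labelled_cycle_def by (auto simp: doubleton_eq_iff)
qed

text \<open>The edge \<open>p z\<close> that serves \<open>u\<close> becomes the path
  \<open>p l z\<close>. Being a neighbour of \<open>u\<close>, the vertex \<open>l\<close> is within
  3 of the end that is within 2 of \<open>u\<close>, and within 4 of the other end. So the new edge
  at the former end can serve \<open>l\<close>, and the new edge at the latter can serve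
  \<open>u\<close>.\<close>

lemma labelled_cycle_insert:
  assumes "sym E" "l \<notin> T" "u \<in> T" "(l, u) \<in> E" "l \<notin> set vs"
    and "labelled_cycle (near E T) T {} vs ts"
  shows "\<exists>ts. labelled_cycle (near E (insert l T)) (insert l T) {} vs ts"
proof -
  let ?N = "near E (insert l T)"
  obtain bs z p where bs: "labelled_cycle (near E T) T {} vs (bs @ [(u, z)])"
    "labelled_walk (serves (near E T) {}) z bs p" "serves (near E T) {} u p z"
    by (rule labelled_cycle_at_label[OF assms(6,3)])
  have mono: "near E T k a b \<Longrightarrow> ?N k a b" for k a b
    by (rule near_mono_set) auto
  have walk: "labelled_walk (serves ?N {}) z bs p"
    using bs(2) by (rule labelled_walk_mono) (auto simp: serves_def mono)
  have dih: "dihedral vs (filter (\<lambda>v. v \<in> set vs) (map snd bs @ [l, z]))"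
    using bs(1) assms(5) unfolding labelled_cycle_def by simp
  have lu: "?N 1 l u" using assms(3,4) by (intro near_edge) auto
  have ext: "?N (Suc k) l a" if "?N k u a" for k a
    using near_trans[OF lu that] by simp
  have sym: "?N k a b \<Longrightarrow> ?N k b a" for k a b
    by (rule near_sym[OF assms(1)])
  have ul: "?N 2 u l" by (rule near_mono[OF sym[OF lu]]) simp
  have ll: "?N 2 l l" by (rule near_refl)
  from bs(3) consider "?N 2 u p" "?N 3 u z" | "?N 3 u p" "?N 2 u z"
    unfolding serves_def using mono by blast
  then show ?thesis
  proof cases
    case 1
    then have "?N 3 l p" "?N 4 l z" using ext[of 2 p] ext[of 3 z] by (simp_all add: eval_nat_numeral)
    moreover from this have "?N 4 p l" using near_mono[of E _ 3 l p 4] sym by simp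
    ultimately have "serves ?N {} l p l" "serves ?N {} u l z"
      unfolding serves_def using 1 ul ll by auto
    with bs(1) assms(2) walk dih show ?thesis
      using labelled_cycle_splice[of _ T _ vs bs u z l l u ?N "{}" p vs] by blast
  next
    case 2
    then have "?N 4 l p" "?N 3 l z" using ext[of 3 p] ext[of 2 z] by (simp_all add: eval_nat_numeral)
    moreover from this have "?N 4 p l" "?N 4 l z" using near_mono[of E _ 3 l z 4] sym by simp_all
    ultimately have "serves ?N {} u p l" "serves ?N {} l l z"
      unfolding serves_def using 2 ul ll by auto
    with bs(1) assms(2) walk dih show ?thesis
      using labelled_cycle_splice[of _ T _ vs bs u z l u l ?N "{}" p vs] by blast
  qed
qed

text \<open>By the stronger condition, \<open>u\<close> is an end of the edge labelled
  \<open>u\<close>, and this edge has length at most 3. Inserting \<open>l\<close> there puts it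
  next to \<open>u\<close>, so that it inherits the place of \<open>u\<close> in the order. The edge
  \<open>u l\<close> serves \<open>l\<close>. The other new edge has length at most 4 and serves
  \<open>u\<close>, which the stronger condition no longer binds.\<close>

lemma labelled_cycle_shift:
  assumes "sym E" "l \<notin> T" "u \<in> T" "(l, u) \<in> E" "u \<notin> set vs" "l \<in> set vs"
    and vs': "vs' = map (\<lambda>v. if v = l then u else v) vs"
    and "labelled_cycle (near E T) T (set vs') vs' ts"
  shows "\<exists>ts. labelled_cycle (near E (insert l T)) (insert l T) (set vs) vs ts"
proof -
  let ?N = "near E (insert l T)" and ?g = "\<lambda>v. if v = u then l else v"
  obtain bs z p where bs: "labelled_cycle (near E T) T (set vs') vs' (bs @ [(u, z)])"
    "labelled_walk (serves (near E T) (set vs')) z bs p" "serves (near E T) (set vs') u p z"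
    by (rule labelled_cycle_at_label[OF assms(8,3)])
  have mono: "near E T k a b \<Longrightarrow> ?N k a b" for k a b
    by (rule near_mono_set) auto
  have mem: "v \<in> set vs \<longleftrightarrow> v \<in> set vs'" if "v \<in> T" "v \<noteq> u" for v
    using that assms(2) unfolding vs' by auto
  have "u \<in> set vs'" using assms(6) unfolding vs' by force
  have "l \<noteq> u" using assms(2,3) by blast
  have vs: "vs = map ?g vs'"
    unfolding vs' using assms(5) by (auto simp: comp_def intro!: map_idI[symmetric])
  have "fst ` set bs \<subseteq> T - {u}"
    using bs(1) unfolding labelled_cycle_def by auto
  then have "serves ?N (set vs) w a b" if "w \<in> fst ` set bs" "serves (near E T) (set vs') w a b" for w a b
    using that mem[of w] assms(2) unfolding serves_def using mono by blast
  then have walk: "labelled_walk (serves ?N (set vs)) z bs p"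
    using bs(2) by (rule labelled_walk_mono[rotated])
  have near_pz: "?N 3 p z" "p = u \<or> z = u"
    using bs(3) \<open>u \<in> set vs'\<close> mono unfolding serves_def by blast+
  have verts: "set (map snd bs) \<subseteq> T" "z \<in> T" "distinct (map snd bs @ [z])"
    using bs(1) unfolding labelled_cycle_def by auto
  let ?F = "filter (\<lambda>v. v \<in> set vs)" and ?F' = "filter (\<lambda>v. v \<in> set vs')"
  \<comment> \<open>Writing \<open>l\<close> for \<open>u\<close> in the old order gives the order
    demanded by \<open>vs\<close>. As \<open>l\<close> is inserted next to \<open>u\<close>,
    filtering the new cycle by \<open>vs\<close> produces this same list.\<close>
  have dih: "dihedral vs (map ?g (?F' (map snd bs @ [z])))"
    using dihedral_map[of vs' "?F' (map snd bs @ [z])" ?g] bs(1)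
    unfolding labelled_cycle_def vs[symmetric] by simp
  have FF': "map ?g (?F' xs) = ?F xs" if "set xs \<subseteq> T" "u \<notin> set xs" for xs
    using that mem assms(2) by (induction xs) auto
  have lu: "?N 1 l u" using assms(3,4) by (intro near_edge) auto
  have sym: "?N k a b \<Longrightarrow> ?N k b a" for k a b
    by (rule near_sym[OF assms(1)])
  have ul: "?N k u l" "?N k l u" if "1 \<le> k" for k
    using near_mono[OF lu that] near_mono[OF sym[OF lu] that] by blast+
  show ?thesis
  proof (cases "z = u")
    case True
    then have "?N 3 p u" using near_pz by simp
    then have "?N 4 p l" "?N 3 u p" using near_trans[OF _ sym[OF lu], of 3 p] sym by simp_all
    then have "serves ?N (set vs) u p l" "serves ?N (set vs) l l u"
      using ul assms(5) near_refl unfolding serves_def by auto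
    moreover have "u \<notin> set (map snd bs)" using verts(3) True by auto
    then have "map ?g (?F' (map snd bs @ [z])) = ?F (map snd bs @ [l, z])"
      using FF'[of "map snd bs"] verts(1) True assms(5,6) \<open>u \<in> set vs'\<close> by simp
    ultimately show ?thesis
      using labelled_cycle_splice[of _ T _ vs' bs u z l u l ?N "set vs" p vs] bs(1) assms(2) walk dih True
      by auto
  next
    case False
    then have "p = u" using near_pz by simp
    then have "?N 3 u z" using near_pz by simp
    then have "?N 4 l z" using near_trans[OF lu, of 3 z] by simp
    then have "serves ?N (set vs) l u l" "serves ?N (set vs) u l z"
      using ul assms(5) near_refl \<open>?N 3 u z\<close> unfolding serves_def by auto
    \<comment> \<open>Here the last step of \<open>bs\<close> arrives at \<open>u\<close>, so
      \<open>l\<close> is placed directly after \<open>u\<close>.\<close>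
    moreover have "last (z # map snd bs) = u"
      using labelled_walk_last[OF walk] \<open>p = u\<close> by simp
    then have "map snd bs \<noteq> [] \<and> last (map snd bs) = u"
      using False by (auto split: if_splits)
    then obtain cs where cs: "map snd bs = cs @ [u]"
      by (metis append_butlast_last_id)
    have "u \<notin> set cs" "set cs \<subseteq> T" using verts unfolding cs by auto
    then have "map ?g (?F' (map snd bs @ [z])) = ?F (map snd bs @ [l, z])"
      using FF'[of cs] FF'[of "[z]"] verts(2) False assms(5,6) \<open>u \<in> set vs'\<close> unfolding cs
      by (simp split: if_splits)
    ultimately show ?thesis
      using labelled_cycle_splice[of _ T _ vs' bs u z l l u ?N "set vs" p vs] bs(1) assms(2) walk dih \<open>p = u\<close>
      by auto
  qed
qed

text \<open>Each round deletes a non-cut vertex \<open>l\<close> and prescribes its neighbour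
  \<open>u\<close> instead. The hypothesis on non-cut vertices survives: if \<open>k\<close> other
  than \<open>u\<close> is non-cut in \<open>T\<close>, then \<open>T - {k}\<close> contains
  \<open>u\<close>, so it stays connected when \<open>l\<close> is added back, and \<open>k\<close>
  was already non-cut in \<open>S\<close>. When no such pair is left,
  \<open>labelled_cycle_base\<close> applies.\<close>

lemma labelled_cycle_of_marked_non_cut_vertices:
  assumes "sym E" "finite S" "connected_on E S"
    and "distinct vs" "length vs = 4" "set vs \<subseteq> S"
    and "\<And>l. l \<in> S \<Longrightarrow> connected_on E (S - {l}) \<Longrightarrow> l \<in> set vs"
  shows "\<exists>ts. labelled_cycle (near E S) S (set vs) vs ts"
  using assms(2-)
proof (induction "card S" arbitrary: S vs rule: less_induct)
  case less
  show ?case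
  proof (cases "\<exists>l u. l \<in> S \<and> connected_on E (S - {l}) \<and> u \<in> S \<and> (l, u) \<in> E \<and> u \<notin> set vs")
    case True
    then obtain l u where l: "l \<in> S" "connected_on E (S - {l})" and u: "u \<in> S" "(l, u) \<in> E" "u \<notin> set vs"
      by blast
    have lvs: "l \<in> set vs" using less.prems(6) l by blast
    define vs' where "vs' = map (\<lambda>v. if v = l then u else v) vs"
    define T where "T = S - {l}"
    have T: "insert l T = S" "l \<notin> T" "u \<in> T" using l(1) u lvs unfolding T_def by auto
    have set_vs': "set vs' = insert u (set vs - {l})"
      using lvs unfolding vs'_def by auto
    have "\<exists>ts. labelled_cycle (near E T) T (set vs') vs' ts"
    proof (rule less.hyps)
      show "card T < card S" unfolding T_def using l(1) less.prems(1) by (rule card_Diff1_less[rotated])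
      show "finite T" using less.prems(1) unfolding T_def by simp
      show "connected_on E T" using l(2) unfolding T_def .
      show "distinct vs'"
        using less.prems(3) u(3) unfolding vs'_def distinct_map by (auto simp: inj_on_def)
      show "length vs' = 4" using less.prems(4) unfolding vs'_def by simp
      show "set vs' \<subseteq> T" using less.prems(5) T(3) unfolding set_vs' T_def by blast
      fix k assume k: "k \<in> T" "connected_on E (T - {k})"
      show "k \<in> set vs'"
      proof (cases "k = u")
        case False
        have "(u, l) \<in> E" using u(2) assms(1) by (auto dest: symD)
        then have "connected_on E (insert l (T - {k}))"
          using connected_on_insert[OF assms(1) k(2)] T(3) False by blast
        moreover have "insert l (T - {k}) = S - {k}" using T k(1) by auto
        ultimately have "k \<in> set vs" using less.prems(6)[of k] k(1) T(1) by auto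
        then show ?thesis using k(1) T(2) unfolding set_vs' by blast
      qed (simp add: set_vs')
    qed
    then show ?thesis
      using labelled_cycle_shift[OF assms(1) T(2,3) u(2,3) lvs vs'_def] unfolding T(1) by blast
  next
    case False
    then show ?thesis
      using labelled_cycle_base[OF assms(1) less.prems] by blast
  qed
qed

text \<open>Non-cut vertices that are not prescribed are removed and later reinserted. When none is
  left, the previous lemma applies, and its cycle is weakened to the empty set of marks under which
  the insertions are made.\<close>

lemma exists_labelled_cycle:
  assumes "sym E" "finite S" "connected_on E S"
    and vs: "distinct vs" "length vs = 4" and "set vs \<subseteq> S"
  shows "\<exists>ts. labelled_cycle (near E S) S {} vs ts"
  using assms(2,3,6)
proof (induction "card S" arbitrary: S rule: less_induct)
  case less
  show ?case
  proof (cases "\<exists>l\<in>S - set vs. connected_on E (S - {l})")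
    case True
    then obtain l where l: "l \<in> S" "l \<notin> set vs" "connected_on E (S - {l})" by blast
    define T where "T = S - {l}"
    have T: "insert l T = S" "l \<notin> T" using l(1) unfolding T_def by auto
    have "\<exists>ts. labelled_cycle (near E T) T {} vs ts"
      using l less.prems unfolding T_def by (intro less.hyps card_Diff1_less) auto
    \<comment> \<open>A prescribed vertex differs from \<open>l\<close>, so \<open>S\<close> has a
      vertex besides \<open>l\<close> and connectedness gives \<open>l\<close> a neighbour in
      \<open>T\<close>.\<close>
    moreover have "vs \<noteq> []" using vs(2) by auto
    then obtain y where "y \<in> S - {l}" using l(2) less.prems(3) by (cases vs) auto
    then obtain u where "u \<in> T" "(l, u) \<in> E"
      unfolding T_def using connected_on_exit[OF less.prems(2), of l "{l}" y] l(1) by auto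
    ultimately show ?thesis
      using labelled_cycle_insert[OF assms(1) T(2) _ _ l(2)] unfolding T(1) by blast
  next
    case False
    then have "\<exists>ts. labelled_cycle (near E S) S (set vs) vs ts"
      using less.prems vs by (intro labelled_cycle_of_marked_non_cut_vertices[OF assms(1)]) auto
    then obtain ts x where "labelled_cycle (near E S) S (set vs) vs ts"
      "labelled_walk (serves (near E S) (set vs)) x ts x"
      unfolding labelled_cycle_def by blast
    moreover from this(2) have "labelled_walk (serves (near E S) {}) x ts x"
      by (rule labelled_walk_mono) (auto simp: serves_def)
    ultimately show ?thesis
      unfolding labelled_cycle_def by blast
  qed
qed

section \<open>From labelled cycles to ordered Hamiltonian cycles\<close>

lemma labelled_walk_successively:
  "labelled_walk P x ts y \<Longrightarrow> (\<And>w a b. P w a b \<Longrightarrow> Q a b) \<Longrightarrow> successively Q (x # map snd ts)"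
  by (induction P x ts y rule: labelled_walk.induct) (auto simp: successively_Cons)

text \<open>A closed labelled walk starts at the last entry of its vertex list. After rotation to
  \<open>v\<close> the closing edge is recorded by repeating \<open>v\<close> at the end.\<close>

lemma successively_cyclic_rotate:
  assumes "successively Q (last (as @ v # bs) # as @ v # bs)"
  shows "successively Q (v # bs @ as @ [v])"
proof (cases bs rule: rev_cases)
  case Nil
  with assms show ?thesis by simp
next
  case (snoc cs b)
  with assms have "successively Q ((b # as) @ (v # cs @ [b]))" by simp
  then have "successively Q ([b] @ as)" "successively Q (v # cs @ [b])" "Q (last (b # as)) v"
    unfolding successively_append_iff[of _ "b # as"] by simp_all
  moreover from this(1) have "successively Q as" "as \<noteq> [] \<longrightarrow> Q b (hd as)"
    unfolding successively_append_iff by auto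
  ultimately show ?thesis
    unfolding snoc using successively_append_iff[of Q "v # cs @ [b]" "as @ [v]"]
    by (cases "as = []") (auto simp: successively_append_iff)
qed

text \<open>Once the cycle starts at the first prescribed vertex, the other three come in the wanted
  order or in its reverse. In the second case the cycle is traversed backwards, which symmetry of
  \<open>near\<close> permits.\<close>

lemma exists_ordered_cycle:
  assumes "sym E" "finite S" "connected_on E S"
    and vs: "distinct vs" "length vs = 4" "set vs \<subseteq> S"
  obtains ys where "distinct ys" "set ys = S" "hd ys = hd vs"
    "successively (near E S 4) (ys @ [hd ys])" "filter (\<lambda>v. v \<in> set vs) ys = vs"
proof -
  let ?F = "filter (\<lambda>v. v \<in> set vs)"
  obtain ts x where ts: "labelled_walk (serves (near E S) {}) x ts x" "distinct (map snd ts)"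
    "snd ` set ts = S" "dihedral vs (?F (map snd ts))"
    using exists_labelled_cycle[OF assms] unfolding labelled_cycle_def by blast
  obtain a b c d where abcd: "vs = [a, b, c, d]"
    using vs(2) by (auto simp: numeral_eq_Suc length_Suc_conv)
  then have "a \<in> set (map snd ts)" using vs(3) ts(3) by auto
  then obtain as bs where xs: "map snd ts = as @ a # bs" by (meson split_list)
  have "successively (near E S 4) (x # map snd ts)"
    using ts(1) by (rule labelled_walk_successively) (simp add: serves_def)
  moreover have "x = last (map snd ts)"
    using labelled_walk_last[OF ts(1)] xs by (simp split: if_splits)
  ultimately have cyc: "successively (near E S 4) (a # (bs @ as) @ [a])"
    using successively_cyclic_rotate[of "near E S 4" as a bs] unfolding xs by simp
  have sym_near: "(\<lambda>x y. near E S 4 y x) = near E S 4"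
    using near_sym[OF assms(1)] by (intro ext iffI)
  have "successively (near E S 4) (rev (a # (bs @ as) @ [a]))"
    unfolding successively_rev sym_near by (rule cyc)
  then have cyc_rev: "successively (near E S 4) (a # rev (bs @ as) @ [a])" by simp
  have set: "set (bs @ as) = S - {a}" "insert a (S - {a}) = S" "distinct (bs @ as)" "a \<notin> set (bs @ as)"
    using ts(2,3) unfolding list.set_map[symmetric] xs by auto
  have "dihedral vs (a # ?F (bs @ as))"
    using dihedral_append_commute[of vs "?F as" "?F (a # bs)"] ts(4) unfolding xs
    by (simp add: abcd)
  then have "?F (bs @ as) = [b, c, d] \<or> ?F (bs @ as) = [d, c, b]"
    using vs(1) unfolding abcd dihedral4 by (elim insertE emptyE) auto
  then show thesis
  proof
    assume F: "?F (bs @ as) = [b, c, d]"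
    show thesis
    proof (rule that[of "a # bs @ as"])
      show "?F (a # bs @ as) = vs" using F by (simp add: abcd)
      show "successively (near E S 4) ((a # bs @ as) @ [hd (a # bs @ as)])" using cyc by simp
    qed (use set in \<open>auto simp: abcd\<close>)
  next
    assume "?F (bs @ as) = [d, c, b]"
    then have F: "?F (rev (bs @ as)) = [b, c, d]" unfolding rev_filter[symmetric] by simp
    show thesis
    proof (rule that[of "a # rev (bs @ as)"])
      show "?F (a # rev (bs @ as)) = vs" using F by (simp add: abcd)
      show "successively (near E S 4) ((a # rev (bs @ as)) @ [hd (a # rev (bs @ as))])" using cyc_rev by simp
    qed (use set in \<open>auto simp: abcd\<close>)
  qed
qed

section \<open>Translation into the walks, distances and cycles of the digraph library\<close>

lemma (in pair_wf_digraph) near_imp_awalk: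
  assumes "near (parcs G) (pverts G) k x y" "x \<in> pverts G"
  shows "\<exists>p. awalk x p y \<and> length p \<le> k"
  using assms(1)
proof (induction k arbitrary: y)
  case 0
  then show ?case using assms(2) by (intro exI[of _ "[]"]) (simp add: near_def awalk_def)
next
  case (Suc k)
  then obtain z where z: "near (parcs G) (pverts G) k x z" "(z, y) \<in> (Restr (parcs G) (pverts G))\<^sup>="
    unfolding near_def by auto
  obtain p where p: "awalk x p z" "length p \<le> k"
    using Suc.IH[OF z(1)] by blast
  show ?case
  proof (cases "z = y")
    case True
    with p show ?thesis by (intro exI[of _ p]) simp
  next
    case False
    with z(2) have "(z, y) \<in> parcs G" "y \<in> pverts G" "z \<in> pverts G" by auto
    then have "awalk z [(z, y)] y" by (simp add: awalk_def)
    with p show ?thesis by (intro exI[of _ "p @ [(z, y)]"]) auto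
  qed
qed

lemma (in pair_wf_digraph) near_imp_graph_dist:
  assumes "near (parcs G) (pverts G) k x y" "x \<in> pverts G"
  shows "graph_dist G x y \<le> ereal (real k)"
proof -
  have "wf_digraph (with_proj G)"
    by unfold_locales (use wellformed' in auto)
  obtain p where p: "awalk x p y" "length p \<le> k"
    using near_imp_awalk[OF assms] by blast
  then have "graph_dist G x y \<le> ereal (awalk_cost (\<lambda>_. 1) p)"
    unfolding graph_dist_def using \<open>wf_digraph (with_proj G)\<close>
    by (intro wf_digraph.min_cost_le_walk_cost)
  also have "awalk_cost (\<lambda>_. 1) p = real (length p)"
    by (induction p) (simp_all add: awalk_cost_def)
  finally show ?thesis
    using p(2) by (meson ereal_less_eq(3) of_nat_le_iff order_trans)
qed

lemma connected_imp_connected_on: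
  assumes "Digraph_Component.connected (with_proj G)" "sym (parcs G)"
  shows "connected_on (parcs G) (pverts G)"
  unfolding connected_on_def
proof (intro ballI)
  fix x y assume "x \<in> pverts G" "y \<in> pverts G"
  \<comment> \<open>The library's connectedness refers to the symmetric closure of the arcs, which
    adds nothing here.\<close>
  moreover have "(parcs G)\<^sup>s = parcs G"
    using assms(2) by (auto simp: symcl_def dest: symD)
  ultimately have "(x, y) \<in> rtrancl_on (pverts G) (parcs G)"
    using assms(1) unfolding connected_conv by simp
  then show "(x, y) \<in> (Restr (parcs G) (pverts G))\<^sup>*"
    by (induction rule: rtrancl_on_induct) (auto intro: rtrancl_into_rtrancl)
qed

lemma cas_zip:
  assumes "ys \<noteq> []"
  shows "pre_digraph.cas (with_proj H) (hd ys) (zip ys (tl ys @ [z])) z"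
  using assms
proof (induction ys)
  case (Cons a ys)
  then show ?case
    by (cases ys) (simp_all add: pre_digraph.cas.simps)
qed simp

lemma hamiltonian_cycle_zip:
  assumes "distinct ys" "set ys = pverts H" "3 \<le> length ys"
    and "successively (\<lambda>a b. (a, b) \<in> parcs H) (ys @ [hd ys])"
  shows "hamiltonian_cycle H (zip ys (tl ys @ [hd ys]))"
proof -
  let ?p = "zip ys (tl ys @ [hd ys])"
  have ne: "ys \<noteq> []" using assms(3) by auto
  have len: "length (tl ys @ [hd ys]) = length ys" using ne by simp
  have "?p \<noteq> []" using ne by (cases ys) auto
  have cas: "pre_digraph.cas (with_proj H) (hd ys) ?p (hd ys)"
    using ne by (rule cas_zip)
  have "set ?p \<subseteq> parcs H"
  proof
    fix e assume "e \<in> set ?p"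
    then obtain i where i: "i < length ys" "e = (ys ! i, (tl ys @ [hd ys]) ! i)"
      by (auto simp: set_zip)
    have "tl ys @ [hd ys] = tl (ys @ [hd ys])" using ne by simp
    then have "(tl ys @ [hd ys]) ! i = (ys @ [hd ys]) ! Suc i"
      using i(1) by (simp only: nth_tl length_tl length_append length_Cons list.size)
    moreover have "ys ! i = (ys @ [hd ys]) ! i"
      using i(1) by (simp add: nth_append)
    ultimately show "e \<in> parcs H"
      using assms(4) i unfolding successively_conv_nth by simp
  qed
  then have "pre_digraph.awalk (with_proj H) (hd ys) ?p (hd ys)"
    using cas ne assms(2) unfolding pre_digraph.awalk_def by auto
  \<comment> \<open>A library cycle asks for distinctness of the visited vertices without the first,
    which recurs at the end.\<close>
  moreover have "tl (pre_digraph.awalk_verts (with_proj H) (hd ys) ?p) = map snd ?p"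
    using pre_digraph.awalk_verts_conv'[OF cas] \<open>?p \<noteq> []\<close> by simp
  moreover have "map snd ?p = tl ys @ [hd ys]"
    using len by simp
  moreover have "distinct (tl ys @ [hd ys])"
    using assms(1) ne by (cases ys) auto
  ultimately have "pre_digraph.cycle (with_proj H) ?p"
    unfolding pre_digraph.cycle_def using \<open>?p \<noteq> []\<close> by metis
  then show ?thesis
    unfolding hamiltonian_cycle_def using assms(2,3) len by (auto simp: map_fst_zip simp del: length_append)
qed

theorem theorem5p1:
  fixes G :: "'a pair_pre_digraph"
  assumes "pair_graph G"
    and "Digraph_Component.connected (with_proj G)"
    and "4 \<le> card (pverts G)"
  shows "k_ordered_hamiltonian 4 (graph_power G 4)"
proof -
  interpret pair_graph G by fact
  let ?H = "graph_power G 4"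
  have sym: "sym (parcs G)"
    using pair_sym_arcs unfolding symmetric_def by simp
  have pverts: "pverts ?H = pverts G" unfolding graph_power_def by simp
  have "\<exists>p. hamiltonian_cycle ?H p \<and> cycle_visits_in_order p vs"
    if vs: "length vs = 4" "distinct vs" "set vs \<subseteq> pverts G" for vs
  proof -
    obtain ys where ys: "distinct ys" "set ys = pverts G" "hd ys = hd vs"
      "successively (near (parcs G) (pverts G) 4) (ys @ [hd ys])"
      "filter (\<lambda>v. v \<in> set vs) ys = vs"
      by (rule exists_ordered_cycle[OF sym pair_finite_verts
            connected_imp_connected_on[OF assms(2) sym] vs(2,1,3)])
    have len: "4 \<le> length ys"
      using assms(3) distinct_card[OF ys(1)] ys(2) by simp
    then have "ys \<noteq> []" by auto
    have "((ys @ [hd ys]) ! i, (ys @ [hd ys]) ! Suc i) \<in> parcs ?H" if "i < length ys" for i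
    proof -
      let ?a = "(ys @ [hd ys]) ! i" and ?b = "(ys @ [hd ys]) ! Suc i"
      have near: "near (parcs G) (pverts G) 4 ?a ?b"
        using ys(4) that unfolding successively_conv_nth by simp
      have a: "?a = ys ! i" using that by (simp add: nth_append)
      have b: "?b = (if Suc i < length ys then ys ! Suc i else ys ! 0)"
        using that \<open>ys \<noteq> []\<close> by (auto simp: nth_append hd_conv_nth less_Suc_eq)
      \<comment> \<open>Arcs of the power join distinct vertices. For the arc closing the cycle this
        holds because \<open>ys\<close> has more than one entry.\<close>
      have "?a \<noteq> ?b"
        unfolding a b using that len \<open>ys \<noteq> []\<close> nth_eq_iff_index_eq[OF ys(1), of i "Suc i"]
          nth_eq_iff_index_eq[OF ys(1), of i 0] by (cases "Suc i < length ys") auto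
      moreover have "?a \<in> pverts G" "?b \<in> pverts G"
        unfolding a b ys(2)[symmetric] using that \<open>ys \<noteq> []\<close> by auto
      moreover have "graph_dist G ?a ?b \<le> ereal (real 4)"
        using near calculation(2) by (rule near_imp_graph_dist)
      ultimately show ?thesis unfolding graph_power_def by simp
    qed
    then have "successively (\<lambda>a b. (a, b) \<in> parcs ?H) (ys @ [hd ys])"
      unfolding successively_conv_nth by simp
    then have ham: "hamiltonian_cycle ?H (zip ys (tl ys @ [hd ys]))" (is "hamiltonian_cycle ?H ?p")
      using ys(1,2) len by (intro hamiltonian_cycle_zip) (simp_all add: pverts)
    have fst_p: "map fst ?p = ys" using \<open>ys \<noteq> []\<close> by simp
    then have "fst (hd ?p) = hd ys" using \<open>ys \<noteq> []\<close> by (metis hd_map list.map_disc_iff)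
    moreover have "subseq vs (map fst ?p)"
      unfolding fst_p using subseq_filter_left[of "\<lambda>v. v \<in> set vs" ys] unfolding ys(5) .
    \<comment> \<open>The traversal is \<open>?p\<close> itself: \<open>ys\<close> was chosen with
      the right start and direction.\<close>
    moreover have "?p = rotate 0 ?p" by simp
    ultimately have "cycle_visits_in_order ?p vs"
      unfolding cycle_visits_in_order_def using ys(3) by metis
    with ham show ?thesis by blast
  qed
  then show ?thesis
    unfolding k_ordered_hamiltonian_def pverts by blast
qed

end
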